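(* Let $\mathcal F_0$ be the $\sigma$-algebra of pre-certification information, and let a selective policy $(a^\star, G_{\widehat\theta})$ be given all of whose ingredients (candidate actions, detector $f$, detector threshold $\tau$, score functions, action order, gate threshold $\widehat\theta$) are $\mathcal F_0$-measurable. Suppose that, conditionally on $\mathcal F_0$, the certification units $Z_i=(X_i,M_i)$, $i=1,\dots,N_{\mathrm{cert}}$, are i.i.d. from a distribution $\mathcal D$ and independent of the data used to construct $\mathcal F_0$. Let $\alpha_{\mathrm{loss}},\alpha_{\mathrm{act}}\in(0,1)$ and $\delta\in(0,1)$. Let $R_{\mathrm{loss}}(\widehat\theta)$ and $R_{\mathrm{act}}(\widehat\theta)$ be the two policy risks, and let $U_{\mathrm{loss}}=U(e_{\mathrm{loss}},n_{\mathrm{loss}};\delta/2)$ and $U_{\mathrm{act}}=U(e_{\mathrm{act}},n_{\mathrm{act}};\delta/2)$ be the one-sided Clopper--Pearson upper bounds computed from the certification counts (all as defined in the context). Then, almost surely, $$ \Pr\Bigl( U_{\mathrm{loss}}\le\alpha_{\mathrm{loss}},\ U_{\mathrm{act}}\le\alpha_{\mathrm{act}},\ \text{and } \bigl[R_{\mathrm{loss}}(\widehat\theta)>\alpha_{\mathrm{loss}}\ \text{or}\ R_{\mathrm{act}}(\widehat\theta)>\alpha_{\mathrm{act}}\bigr]\ \Bigm|\ \mathcal F_0\Bigr)\le\delta . $$ The same inequality holds unconditionally, i.e. with $\Pr(\,\cdot\mid\mathcal F_0)$ replaced by $\Pr(\,\cdot\,)$.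
   Context: Units. A unit is a pair $(X,M)$, where $X$ is an observed image (an element of a measurable space of images) and $M\in\{0,1\}^{H\times W}$ is a binary defect mask, with pixels indexed by $u$. The unit is called positive if $M\ne 0$ and clean if $M=0$. Every image is assumed to have a nonempty clean region, i.e. $\sum_u(1-M_u)>0$. Policy. There is a finite ordered list of (non-review) actions $a_1,\dots,a_K$ (in the paper $K=6$: a raw display and five restorations); each maps $X$ to an image $a_k(X)\in\mathbb R^{H\times W}$. A detector $f$ maps such an image to a pixelwise score map in $\mathbb R^{H\times W}$, and $\tau\in\mathbb R$ is the detector threshold. For each $k$ there are two real-valued score functions $\widehat s_{\mathrm{loss},k}(X)$ and $\widehat s_{\mathrm{act},k}(X)$. Put $$q_k(X)=\max\{\widehat s_{\mathrm{loss},k}(X)/\alpha_{\mathrm{loss}},\ \widehat s_{\mathrm{act},k}(X)/\alpha_{\mathrm{act}}\},\qquad q^\star(X)=\min_k q_k(X),$$ and let $a^\star(X)$ be the action minimizing $q_k(X)$ over $k$, with ties broken by the fixed order of actions. The return gate is $G_{\widehat\theta}(X)=\mathbf 1\{q^\star(X)\le\widehat\theta\}$, with $\widehat\theta$ a threshold ($\widehat\theta=-\infty$, i.e. $G_{\widehat\theta}\equiv 0$, is allowed and represents having no automatic-return region). Saying these objects are $\mathcal F_0$-measurable means that conditionally on $\mathcal F_0$ they are fixed (nonrandom) measurable functions or constants. Incidents. Fix constants $r_0,f_0\in[0,1]$ (in the paper $r_0=0.25$, $f_0=0.002$). For an action $a$ let $$\operatorname{Rec}(a)=\frac{\sum_u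 M_u\mathbf 1\{f(a(X))_u\ge\tau\}}{\sum_u M_u}\ \ (M\neq0),\qquad \operatorname{FPR}_c(a)=\frac{\sum_u(1-M_u)\mathbf 1\{f(a(X))_u\ge\tau\}}{\sum_u(1-M_u)}.$$ The evidence-loss incident is $\ell_{\mathrm{loss}}(a)=\mathbf 1\{\operatorname{Rec}(a)<r_0\}$, defined only when $M\ne0$. The excess-activation incident is $\ell_{\mathrm{act}}(a)=\mathbf 1\{\operatorname{FPR}_c(a)>f_0\}$, defined for every image. For unit $i$, $\ell_{\mathrm{loss},i}$ and $\ell_{\mathrm{act},i}$ denote these indicators evaluated at $(X_i,M_i)$ with $a=a^\star(X_i)$. Policy risks. With the policy fixed (i.e. given $\mathcal F_0$) and $(X,M)\sim\mathcal D$, $$R_{\mathrm{loss}}(\widehat\theta)=\Pr\{\ell_{\mathrm{loss}}(a^\star)=1\mid G_{\widehat\theta}(X)=1,\ M\ne0\},\qquad R_{\mathrm{act}}(\widehat\theta)=\Pr\{\ell_{\mathrm{act}}(a^\star)=1\mid G_{\widehat\theta}(X)=1\}.$$ These are $\mathcal F_0$-measurable. If a conditioning event has probability zero, the corresponding risk is undefined and may be assigned any ($\mathcal F_0$-measurable) value in $[0,1]$. Certification counts. All sums are over $i=1,\dots,N_{\mathrm{cert}}$, with $N_{\mathrm{cert}}$ a fixed sample size: $$n_{\mathrm{loss}}=\sum_i\mathbf 1\{G_{\widehat\theta}(X_i)=1,M_i\ne0\},\quad e_{\mathrm{loss}}=\sum_i\mathbf 1\{G_{\widehat\theta}(X_i)=1,M_i\ne0,\ell_{\mathrm{loss},i}=1\},$$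 $$n_{\mathrm{act}}=\sum_i\mathbf 1\{G_{\widehat\theta}(X_i)=1\},\quad e_{\mathrm{act}}=\sum_i\mathbf 1\{G_{\widehat\theta}(X_i)=1,\ell_{\mathrm{act},i}=1\}.$$ Clopper--Pearson bound. For $0<\gamma<1$ and integers $0\le e\le n$, $$U(e,n;\gamma)=\begin{cases}1,& n=0\text{ or }e=n,\\ \operatorname{Beta}^{-1}(1-\gamma;\,e+1,\,n-e),&0\le e<n,\end{cases}$$ where $\operatorname{Beta}^{-1}(p;a,b)$ is the $p$-quantile of the Beta distribution with parameters $(a,b)$. *)

theory Defs
  imports "HOL-Probability.Probability"
begin

section \<open>Units, images and masks\<close>

text \<open>
  Pixels are pairs of a row in \<open>'h\<close> and a column in \<open>'w\<close>. A mask is a boolean vector whose entries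
  are read as 0 and 1 through \<^const>\<open>of_bool\<close>. Units live on a space that contains only masks with
  a nonempty clean region.
\<close>

type_synonym ('h, 'w) image = "real ^ ('h \<times> 'w)"
type_synonym ('h, 'w) mask = "bool ^ ('h \<times> 'w)"

definition positive_mask :: "('h::finite, 'w::finite) mask \<Rightarrow> bool" where
  "positive_mask m \<longleftrightarrow> m \<noteq> (\<chi> u. False)"

definition unit_space :: "'x measure \<Rightarrow> ('x \<times> ('h::finite, 'w::finite) mask) measure" where
  "unit_space SX =
     SX \<Otimes>\<^sub>M count_space {m. (0::real) < (\<Sum>u\<in>UNIV. 1 - of_bool (m $ u))}"


section \<open>Selective policies\<close>

text \<open>
  The actions of a policy are numbered from 1 to a fixed \<open>K\<close>; the numbering is the action order.
  The gate threshold is extended-real so that it can be \<open>-\<infinity>\<close>.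
\<close>

record ('x, 'h, 'w) policy =
  action :: "nat \<Rightarrow> 'x \<Rightarrow> ('h::finite, 'w::finite) image"
  detector :: "('h, 'w) image \<Rightarrow> ('h, 'w) image"
  detector_threshold :: real
  score_loss :: "nat \<Rightarrow> 'x \<Rightarrow> real"
  score_act :: "nat \<Rightarrow> 'x \<Rightarrow> real"
  gate_threshold :: ereal

definition q_score :: "real \<Rightarrow> real \<Rightarrow> ('x, 'h::finite, 'w::finite) policy \<Rightarrow> nat \<Rightarrow> 'x \<Rightarrow> real" where
  "q_score \<alpha>\<^sub>l \<alpha>\<^sub>a p k x = max (score_loss p k x / \<alpha>\<^sub>l) (score_act p k x / \<alpha>\<^sub>a)"

definition q_star ::
  "real \<Rightarrow> real \<Rightarrow> nat \<Rightarrow> ('x, 'h::finite, 'w::finite) policy \<Rightarrow> 'x \<Rightarrow> real" where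
  "q_star \<alpha>\<^sub>l \<alpha>\<^sub>a K p x = Min ((\<lambda>k. q_score \<alpha>\<^sub>l \<alpha>\<^sub>a p k x) ` {1..K})"

definition selected_index ::
  "real \<Rightarrow> real \<Rightarrow> nat \<Rightarrow> ('x, 'h::finite, 'w::finite) policy \<Rightarrow> 'x \<Rightarrow> nat" where
  "selected_index \<alpha>\<^sub>l \<alpha>\<^sub>a K p x =
     (LEAST k. k \<in> {1..K} \<and> q_score \<alpha>\<^sub>l \<alpha>\<^sub>a p k x = q_star \<alpha>\<^sub>l \<alpha>\<^sub>a K p x)"

definition a_star ::
  "real \<Rightarrow> real \<Rightarrow> nat \<Rightarrow> ('x, 'h::finite, 'w::finite) policy \<Rightarrow> 'x \<Rightarrow> ('h, 'w) image" where
  "a_star \<alpha>\<^sub>l \<alpha>\<^sub>a K p x = action p (selected_index \<alpha>\<^sub>l \<alpha>\<^sub>a K p x) x"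

definition gate ::
  "real \<Rightarrow> real \<Rightarrow> nat \<Rightarrow> ('x, 'h::finite, 'w::finite) policy \<Rightarrow> 'x \<Rightarrow> bool" where
  "gate \<alpha>\<^sub>l \<alpha>\<^sub>a K p x \<longleftrightarrow> ereal (q_star \<alpha>\<^sub>l \<alpha>\<^sub>a K p x) \<le> gate_threshold p"

text \<open>
  For a random policy, measurability of its ingredients with respect to \<open>F\<^sub>0\<close> is joint measurability
  in the outcome and the argument: each outcome yields measurable functions, chosen in an
  \<open>F\<^sub>0\<close>-measurable way.
\<close>

definition policy_measurable ::
  "'a measure \<Rightarrow> 'x measure \<Rightarrow> nat \<Rightarrow> ('a \<Rightarrow> ('x, 'h::finite, 'w::finite) policy) \<Rightarrow> bool" where
  "policy_measurable F\<^sub>0 SX K \<pi> \<longleftrightarrow>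
     (\<forall>k\<in>{1..K}. (\<lambda>(\<omega>, x). action (\<pi> \<omega>) k x) \<in> borel_measurable (F\<^sub>0 \<Otimes>\<^sub>M SX)) \<and>
     (\<lambda>(\<omega>, y). detector (\<pi> \<omega>) y) \<in> borel_measurable (F\<^sub>0 \<Otimes>\<^sub>M borel) \<and>
     (\<lambda>\<omega>. detector_threshold (\<pi> \<omega>)) \<in> borel_measurable F\<^sub>0 \<and>
     (\<forall>k\<in>{1..K}. (\<lambda>(\<omega>, x). score_loss (\<pi> \<omega>) k x) \<in> borel_measurable (F\<^sub>0 \<Otimes>\<^sub>M SX)) \<and>
     (\<forall>k\<in>{1..K}. (\<lambda>(\<omega>, x). score_act (\<pi> \<omega>) k x) \<in> borel_measurable (F\<^sub>0 \<Otimes>\<^sub>M SX)) \<and>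
     (\<lambda>\<omega>. gate_threshold (\<pi> \<omega>)) \<in> borel_measurable F\<^sub>0 \<and>
     (\<forall>\<omega>\<in>space F\<^sub>0. gate_threshold (\<pi> \<omega>) \<noteq> \<infinity>)"


section \<open>Incidents\<close>

text \<open>In what follows \<open>y\<close> is the displayed image, that is, the result of an action.\<close>

definition rec_rate ::
  "('x, 'h::finite, 'w::finite) policy \<Rightarrow> ('h, 'w) image \<Rightarrow> ('h, 'w) mask \<Rightarrow> real" where
  "rec_rate p y m =
     (\<Sum>u\<in>UNIV. of_bool (m $ u) * of_bool (detector p y $ u \<ge> detector_threshold p)) /
     (\<Sum>u\<in>UNIV. of_bool (m $ u))"

definition fpr_clean ::
  "('x, 'h::finite, 'w::finite) policy \<Rightarrow> ('h, 'w) image \<Rightarrow> ('h, 'w) mask \<Rightarrow> real" where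
  "fpr_clean p y m =
     (\<Sum>u\<in>UNIV. (1 - of_bool (m $ u)) * of_bool (detector p y $ u \<ge> detector_threshold p)) /
     (\<Sum>u\<in>UNIV. 1 - of_bool (m $ u))"

text \<open>The loss incident is meaningful for positive masks only and is used for no others.\<close>

definition loss_incident ::
  "real \<Rightarrow> ('x, 'h::finite, 'w::finite) policy \<Rightarrow> ('h, 'w) image \<Rightarrow> ('h, 'w) mask \<Rightarrow> bool" where
  "loss_incident r\<^sub>0 p y m \<longleftrightarrow> rec_rate p y m < r\<^sub>0"

definition act_incident ::
  "real \<Rightarrow> ('x, 'h::finite, 'w::finite) policy \<Rightarrow> ('h, 'w) image \<Rightarrow> ('h, 'w) mask \<Rightarrow> bool" where
  "act_incident f\<^sub>0 p y m \<longleftrightarrow> fpr_clean p y m > f\<^sub>0"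


section \<open>Policy risks\<close>

text \<open>
  \<open>R\<close> is a version of the risk \<open>Pr\<^sub>D(inc | sel)\<close> of a random policy: for each outcome the policy is
  frozen and the probability is taken under \<open>D\<close>. Where the conditioning event is null, the value
  is arbitrary in the unit interval.
\<close>

definition risk_version ::
  "'a measure \<Rightarrow> 'z measure \<Rightarrow> ('a \<Rightarrow> 'z \<Rightarrow> bool) \<Rightarrow> ('a \<Rightarrow> 'z \<Rightarrow> bool) \<Rightarrow> ('a \<Rightarrow> real) \<Rightarrow> bool" where
  "risk_version F\<^sub>0 D inc sel R \<longleftrightarrow>
     R \<in> borel_measurable F\<^sub>0 \<and>
     (\<forall>\<omega>\<in>space F\<^sub>0. 0 \<le> R \<omega> \<and> R \<omega> \<le> 1) \<and>
     (\<forall>\<omega>\<in>space F\<^sub>0. \<P>(z in D. sel \<omega> z) \<noteq> 0 \<longrightarrow> R \<omega> = \<P>(z in D. inc \<omega> z \<bar> sel \<omega> z))"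

definition loss_risk_version ::
  "real \<Rightarrow> real \<Rightarrow> real \<Rightarrow> nat \<Rightarrow> 'a measure \<Rightarrow> ('x \<times> ('h, 'w) mask) measure \<Rightarrow>
    ('a \<Rightarrow> ('x, 'h::finite, 'w::finite) policy) \<Rightarrow> ('a \<Rightarrow> real) \<Rightarrow> bool" where
  "loss_risk_version \<alpha>\<^sub>l \<alpha>\<^sub>a r\<^sub>0 K F\<^sub>0 D \<pi> R \<longleftrightarrow>
     risk_version F\<^sub>0 D
       (\<lambda>\<omega> (x, m). loss_incident r\<^sub>0 (\<pi> \<omega>) (a_star \<alpha>\<^sub>l \<alpha>\<^sub>a K (\<pi> \<omega>) x) m)
       (\<lambda>\<omega> (x, m). gate \<alpha>\<^sub>l \<alpha>\<^sub>a K (\<pi> \<omega>) x \<and> positive_mask m) R"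

definition act_risk_version ::
  "real \<Rightarrow> real \<Rightarrow> real \<Rightarrow> nat \<Rightarrow> 'a measure \<Rightarrow> ('x \<times> ('h, 'w) mask) measure \<Rightarrow>
    ('a \<Rightarrow> ('x, 'h::finite, 'w::finite) policy) \<Rightarrow> ('a \<Rightarrow> real) \<Rightarrow> bool" where
  "act_risk_version \<alpha>\<^sub>l \<alpha>\<^sub>a f\<^sub>0 K F\<^sub>0 D \<pi> R \<longleftrightarrow>
     risk_version F\<^sub>0 D
       (\<lambda>\<omega> (x, m). act_incident f\<^sub>0 (\<pi> \<omega>) (a_star \<alpha>\<^sub>l \<alpha>\<^sub>a K (\<pi> \<omega>) x) m)
       (\<lambda>\<omega> (x, m). gate \<alpha>\<^sub>l \<alpha>\<^sub>a K (\<pi> \<omega>) x) R"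


section \<open>Certification sample and counts\<close>

definition cond_iid ::
  "'a measure \<Rightarrow> 'a measure \<Rightarrow> 'z measure \<Rightarrow> 'i set \<Rightarrow> ('i \<Rightarrow> 'a \<Rightarrow> 'z) \<Rightarrow> bool" where
  "cond_iid P F\<^sub>0 D I Z \<longleftrightarrow>
     (\<forall>i\<in>I. Z i \<in> P \<rightarrow>\<^sub>M D) \<and>
     (\<forall>A. (\<forall>i\<in>I. A i \<in> sets D) \<longrightarrow>
       (AE \<omega> in P. real_cond_exp P F\<^sub>0 (indicat_real {\<omega>\<in>space P. \<forall>i\<in>I. Z i \<omega> \<in> A i}) \<omega>
          = (\<Prod>i\<in>I. measure D (A i))))"

text \<open>
  Counts for a fixed policy \<open>p\<close> and a fixed sample \<open>z\<close> of units \<open>z 1, \<dots>, z N\<close>.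
\<close>

definition n_loss ::
  "real \<Rightarrow> real \<Rightarrow> nat \<Rightarrow> nat \<Rightarrow> ('x, 'h::finite, 'w::finite) policy \<Rightarrow>
    (nat \<Rightarrow> 'x \<times> ('h, 'w) mask) \<Rightarrow> nat" where
  "n_loss \<alpha>\<^sub>l \<alpha>\<^sub>a K N p z =
     (\<Sum>i\<in>{1..N}. (case z i of (x, m) \<Rightarrow>
        of_bool (gate \<alpha>\<^sub>l \<alpha>\<^sub>a K p x \<and> positive_mask m)))"

definition e_loss ::
  "real \<Rightarrow> real \<Rightarrow> real \<Rightarrow> nat \<Rightarrow> nat \<Rightarrow> ('x, 'h::finite, 'w::finite) policy \<Rightarrow>
    (nat \<Rightarrow> 'x \<times> ('h, 'w) mask) \<Rightarrow> nat" where
  "e_loss \<alpha>\<^sub>l \<alpha>\<^sub>a r\<^sub>0 K N p z =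
     (\<Sum>i\<in>{1..N}. (case z i of (x, m) \<Rightarrow>
        of_bool (gate \<alpha>\<^sub>l \<alpha>\<^sub>a K p x \<and> positive_mask m \<and>
          loss_incident r\<^sub>0 p (a_star \<alpha>\<^sub>l \<alpha>\<^sub>a K p x) m)))"

definition n_act ::
  "real \<Rightarrow> real \<Rightarrow> nat \<Rightarrow> nat \<Rightarrow> ('x, 'h::finite, 'w::finite) policy \<Rightarrow>
    (nat \<Rightarrow> 'x \<times> ('h, 'w) mask) \<Rightarrow> nat" where
  "n_act \<alpha>\<^sub>l \<alpha>\<^sub>a K N p z =
     (\<Sum>i\<in>{1..N}. (case z i of (x, m) \<Rightarrow>
        of_bool (gate \<alpha>\<^sub>l \<alpha>\<^sub>a K p x)))"

definition e_act ::
  "real \<Rightarrow> real \<Rightarrow> real \<Rightarrow> nat \<Rightarrow> nat \<Rightarrow> ('x, 'h::finite, 'w::finite) policy \<Rightarrow>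
    (nat \<Rightarrow> 'x \<times> ('h, 'w) mask) \<Rightarrow> nat" where
  "e_act \<alpha>\<^sub>l \<alpha>\<^sub>a f\<^sub>0 K N p z =
     (\<Sum>i\<in>{1..N}. (case z i of (x, m) \<Rightarrow>
        of_bool (gate \<alpha>\<^sub>l \<alpha>\<^sub>a K p x \<and>
          act_incident f\<^sub>0 p (a_star \<alpha>\<^sub>l \<alpha>\<^sub>a K p x) m)))"


section \<open>Clopper--Pearson bound\<close>

definition beta_distribution :: "real \<Rightarrow> real \<Rightarrow> real measure" where
  "beta_distribution a b = density lborel (\<lambda>x. ennreal
     (if 0 < x \<and> x < 1 then x powr (a - 1) * (1 - x) powr (b - 1) / Beta a b else 0))"

definition quantile :: "real measure \<Rightarrow> real \<Rightarrow> real" where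
  "quantile \<mu> p = Inf {x. p \<le> cdf \<mu> x}"

definition clopper_pearson :: "nat \<Rightarrow> nat \<Rightarrow> real \<Rightarrow> real" where
  "clopper_pearson e n \<gamma> =
     (if n = 0 \<or> e = n then 1
      else quantile (beta_distribution (real e + 1) (real n - real e)) (1 - \<gamma>))"

end

theory Submission
  imports Defs
begin

text \<open>
  Conditionally on \<open>F\<^sub>0\<close> the policy is fixed and the units are i.i.d., so by Fubini it suffices to
  bound, for each outcome, the product measure of the bad samples; the two certificates are
  combined by a union bound with \<open>\<delta>/2\<close> each. For one certificate, the incidents among \<open>n\<close> selected
  units are binomial with parameters \<open>n\<close> and \<open>R\<close>. The lower tail \<open>Pr(Bin(n, p) \<le> k)\<close> is
  \<open>1 - F\<close> with \<open>F\<close> the distribution function of \<open>Beta(k + 1, n - k)\<close> at \<open>p\<close>, as differentiation in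
  \<open>p\<close> telescopes. Hence \<open>U(k, n; \<gamma>) \<le> \<alpha>\<close> forces \<open>Pr(Bin(n, \<alpha>) \<le> k) \<le> \<gamma>\<close>, and a fortiori
  \<open>Pr(Bin(n, R) \<le> k) \<le> \<gamma>\<close> if \<open>R > \<alpha>\<close>.
\<close>


section \<open>The Clopper--Pearson bound and the binomial tail\<close>

definition binomial_cdf :: "nat \<Rightarrow> nat \<Rightarrow> real \<Rightarrow> real" where
  "binomial_cdf n k x = (\<Sum>j\<le>k. real (n choose j) * x ^ j * (1 - x) ^ (n - j))"

lemma binomial_cdf_0: "binomial_cdf n k 0 = 1"
  by (simp add: binomial_cdf_def power_0_left if_distrib if_distribR cong: if_cong)

lemma binomial_cdf_1:
  assumes "k < n"
  shows "binomial_cdf n k 1 = 0"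
  using assms by (auto simp: binomial_cdf_def power_0_left intro!: sum.neutral)

text \<open>By induction on k. The product rule splits the derivative of the new summand into two
  terms. By the absorption identity \<open>c\<close> the positive one cancels the derivative of the
  shorter sum, so only the negative one survives.\<close>

lemma has_field_derivative_binomial_cdf:
  assumes "k < n"
  shows "(binomial_cdf n k has_field_derivative
    - (real (n choose k) * real (n - k) * x ^ k * (1 - x) ^ (n - k - 1))) (at x)"
  using assms
proof (induction k)
  case 0
  show ?case
    unfolding binomial_cdf_def by (auto intro!: derivative_eq_intros)
next
  case (Suc k)
  have eq: "binomial_cdf n (Suc k) = (\<lambda>x. binomial_cdf n k x
      + real (n choose Suc k) * x ^ Suc k * (1 - x) ^ (n - Suc k))"
    by (simp add: binomial_cdf_def fun_eq_iff)
  have "(n choose Suc k) * Suc k = (n choose k) * (n - k)"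
    by (metis binomial_absorb_comp binomial_absorption mult.commute)
  then have c: "real (n choose Suc k) * (1 + real k) = real (n choose k) * real (n - k)"
    by (metis of_nat_Suc of_nat_mult)
  have pow: "((\<lambda>x. x ^ Suc k) has_field_derivative real (Suc k) * x ^ k) (at x)"
    using DERIV_pow[of "Suc k" x] by simp
  have "((\<lambda>x. (1 - x) ^ (n - Suc k)) has_field_derivative
      - (real (n - Suc k) * (1 - x) ^ (n - Suc k - 1))) (at x)"
    by (auto intro!: derivative_eq_intros)
  note d = DERIV_add[OF Suc.IH DERIV_mult[OF DERIV_cmult[OF pow, of "real (n choose Suc k)"] this]]
  have "k < n" using Suc.prems by simp
  then show ?case
    unfolding eq by (intro DERIV_cong[OF d]) (simp_all only: c[symmetric], simp_all add: algebra_simps)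
qed

text \<open>At integer parameters the Gamma values are factorials. The resulting normalising
  constant is exactly the coefficient in the derivative of \<open>binomial_cdf\<close>, which is
  what matches the Beta density with that derivative.\<close>

lemma inverse_Beta_eq_binomial:
  assumes "k < n"
  shows "1 / Beta (real k + 1) (real n - real k) = real (n choose k) * real (n - k)"
proof -
  obtain m where m: "n = k + Suc m"
    using assms less_iff_Suc_add by auto
  have "Gamma (real k + 1) = fact k" "Gamma (1 + real m) = fact m"
    "Gamma (2 + (real k + real m)) = fact (Suc (k + m))"
    using Gamma_fact[of k, where 'a=real] Gamma_fact[of m, where 'a=real]
      Gamma_fact[of "Suc (k+m)", where 'a=real]
    by (simp_all add: add.commute add.left_commute)
  then have "Beta (real k + 1) (real n - real k) = fact k * fact m / fact (Suc (k + m))"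
    unfolding m Beta_def by (simp add: add_ac del: fact_Suc)
  moreover have "real (n choose k) = fact (Suc (k + m)) / (fact k * (real (Suc m) * fact m))"
    using binomial_fact[of k n, where 'a=real] m by (simp del: fact_Suc add: fact_Suc[of m])
  ultimately show ?thesis
    by (simp add: m del: fact_Suc)
qed

text \<open>On the open unit interval the Beta density is minus the derivative of the lower tail, so
  the fundamental theorem of calculus gives the drop of the tail between 0 and x.\<close>

lemma emeasure_beta_distribution_Icc:
  assumes "k < n" "0 \<le> x" "x \<le> 1"
  shows "emeasure (beta_distribution (real k + 1) (real n - real k)) {0..x}
    = ennreal (1 - binomial_cdf n k x)"
proof -
  define c where "c = real (n choose k) * real (n - k)"
  let ?f = "\<lambda>t::real. c * t ^ k * (1 - t) ^ (n - k - 1)"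
  have c: "c \<ge> 0" by (simp add: c_def)
  have "emeasure (beta_distribution (real k + 1) (real n - real k)) {0..x} =
    (\<integral>\<^sup>+t. ennreal (if 0 < t \<and> t < 1 then t powr (real k + 1 - 1) *
      (1 - t) powr (real n - real k - 1) / Beta (real k + 1) (real n - real k) else 0)
      * indicator {0..x} t \<partial>lborel)"
    unfolding beta_distribution_def by (subst emeasure_density) auto
  also have "\<dots> = (\<integral>\<^sup>+t. ennreal (?f t) * indicator {0..x} t \<partial>lborel)"
  proof (rule nn_integral_cong_AE)
    have e: "t powr (real k + 1 - 1) * (1 - t) powr (real n - real k - 1)
        / Beta (real k + 1) (real n - real k) = ?f t" if "0 < t" "t < 1" for t
    proof -
      have "(1 - t) powr (real n - real k - 1) = (1 - t) ^ (n - k - 1)"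
        using that assms(1) powr_realpow[of "1 - t" "n - k - 1"] by (simp add: of_nat_diff algebra_simps)
      then show ?thesis
        using that inverse_Beta_eq_binomial[OF assms(1)] powr_realpow[of t k]
        by (simp add: c_def divide_inverse mult_ac)
    qed
    \<comment> \<open>The density is cut off at 0 and 1, whereas the polynomial \<open>?f\<close>
      can be nonzero at 0 if k = 0 and at 1 if n = k + 1. These two points are null.\<close>
    have "AE t in lborel. t \<noteq> 0 \<and> t \<noteq> (1::real)"
      using AE_lborel_singleton[of 0] AE_lborel_singleton[of "1::real"] by eventually_elim auto
    then show "AE t in lborel. ennreal (if 0 < t \<and> t < 1 then t powr (real k + 1 - 1) *
      (1 - t) powr (real n - real k - 1) / Beta (real k + 1) (real n - real k) else 0)
      * indicator {0..x} t = ennreal (?f t) * indicator {0..x} t"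
      by eventually_elim (use assms e in \<open>auto simp: indicator_def\<close>)
  qed
  also have "\<dots> = ennreal (- binomial_cdf n k x - (- binomial_cdf n k 0))"
  proof (rule nn_integral_FTC_Icc[where F = "\<lambda>t. - binomial_cdf n k t"])
    show "((\<lambda>t. - binomial_cdf n k t) has_real_derivative ?f t) (at t)"
      if "t \<in> {0..x}" for t
      using DERIV_minus[OF has_field_derivative_binomial_cdf[OF assms(1), of t]]
      by (simp add: c_def)
  qed (use assms c in auto)
  also note binomial_cdf_0
  finally show ?thesis by simp
qed

lemma emeasure_beta_distribution_outside:
  assumes "A \<in> sets borel" "A \<inter> {0<..<1} = {}"
  shows "emeasure (beta_distribution a b) A = 0"
proof -
  have "emeasure (beta_distribution a b) A = (\<integral>\<^sup>+x. ennreal (if 0 < x \<and> x < 1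
      then x powr (a - 1) * (1 - x) powr (b - 1) / Beta a b else 0) * indicator A x \<partial>lborel)"
    unfolding beta_distribution_def using assms by (subst emeasure_density) auto
  also have "\<dots> = (\<integral>\<^sup>+x. 0 \<partial>(lborel :: real measure))"
    using assms by (intro nn_integral_cong) (auto split: split_indicator)
  finally show ?thesis by simp
qed

lemma sets_beta_distribution [measurable_cong, simp]: "sets (beta_distribution a b) = sets borel"
  by (simp add: beta_distribution_def)

text \<open>The mass of the closed unit interval is the total drop of the lower tail, from 1 at 0 to
  0 at 1, and the complement is null.\<close>

lemma prob_space_beta_distribution:
  assumes "k < n"
  shows "prob_space (beta_distribution (real k + 1) (real n - real k))" (is "prob_space ?B")
proof
  have "emeasure ?B (space ?B) = emeasure ?B ({0..1} \<union> - {0..1})"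
    by (simp add: beta_distribution_def)
  also have "\<dots> = emeasure ?B {0..1}"
    by (rule emeasure_Un_null_set) (auto simp: null_sets_def intro!: emeasure_beta_distribution_outside)
  also have "\<dots> = 1"
    using emeasure_beta_distribution_Icc[OF assms, of 1] binomial_cdf_1[OF assms] by simp
  finally show "emeasure ?B (space ?B) = 1" .
qed

text \<open>The derivative is nonpositive on the unit interval. This carries a tail bound at the
  target level over to every larger risk.\<close>

lemma binomial_cdf_antimono:
  assumes "k < n" "0 \<le> x" "x \<le> y" "y \<le> 1"
  shows "binomial_cdf n k y \<le> binomial_cdf n k x"
proof (rule DERIV_nonpos_imp_nonincreasing[OF assms(3)])
  fix t assume "x \<le> t" "t \<le> y"
  then have "0 \<le> real (n choose k) * real (n - k) * t ^ k * (1 - t) ^ (n - k - 1)"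
    using assms by simp
  with has_field_derivative_binomial_cdf[OF assms(1), of t]
  show "\<exists>d. (binomial_cdf n k has_real_derivative d) (at t) \<and> d \<le> 0"
    by (metis neg_le_0_iff_le)
qed

lemma cdf_beta_distribution:
  assumes "k < n" "0 \<le> x" "x \<le> 1"
  shows "cdf (beta_distribution (real k + 1) (real n - real k)) x = 1 - binomial_cdf n k x"
proof -
  let ?B = "beta_distribution (real k + 1) (real n - real k)"
  interpret B: prob_space ?B by (rule prob_space_beta_distribution[OF assms(1)])
  have eq: "{..x} = {0..x} \<union> {..<0}" using assms by auto
  have "emeasure ?B {..x} = emeasure ?B {0..x}"
    unfolding eq
    by (rule emeasure_Un_null_set) (auto simp: null_sets_def intro!: emeasure_beta_distribution_outside)
  also note emeasure_beta_distribution_Icc[OF assms]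
  finally have e: "emeasure ?B {..x} = ennreal (1 - binomial_cdf n k x)" .
  \<comment> \<open>The tail is at most 1, so the difference is nonnegative and is recovered
    unchanged from its \<open>ennreal\<close> value.\<close>
  have "binomial_cdf n k x \<le> binomial_cdf n k 0"
    using assms by (intro binomial_cdf_antimono) auto
  also note binomial_cdf_0
  finally show ?thesis
    using e by (simp add: cdf_def measure_def)
qed

section \<open>Inverting the Clopper-Pearson quantile\<close>

lemma le_cdf_if_quantile_le:
  assumes "real_distribution \<mu>" "p \<le> cdf \<mu> b" "quantile \<mu> p \<le> x"
  shows "p \<le> cdf \<mu> x"
proof (rule ccontr)
  interpret real_distribution \<mu> by fact
  assume "\<not> p \<le> cdf \<mu> x"
  then have less: "cdf \<mu> x < p" by simp
  \<comment> \<open>Right continuity keeps the distribution function below p on an interval just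
    after x. The infimum defining the quantile then lies strictly to the right of x, a
    contradiction.\<close>
  have "((\<lambda>y. cdf \<mu> y) \<longlongrightarrow> cdf \<mu> x) (at_right x)"
    using cdf_is_right_cont[of x] by (simp add: continuous_within)
  then have "eventually (\<lambda>y. cdf \<mu> y < p) (at_right x)"
    using less by (rule order_tendstoD)
  then obtain y where y: "x < y" "\<And>z. x < z \<Longrightarrow> z < y \<Longrightarrow> cdf \<mu> z < p"
    unfolding eventually_at_right_field by blast
  define z where "z = (x + y) / 2"
  have z: "x < z" "cdf \<mu> z < p" using y by (auto simp: z_def)
  \<comment> \<open>A point t < z of the set would give p \<le> cdf \<mu> z by monotonicity. The
    point b makes the set nonempty, without which its infimum would be unspecified.\<close>
  have "z \<le> quantile \<mu> p"
    unfolding quantile_def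
  proof (rule cInf_greatest)
    show "z \<le> t" if "t \<in> {t. p \<le> cdf \<mu> t}" for t
      using that z cdf_nondecreasing[of t z] by (cases "z \<le> t") auto
  qed (use assms(2) in auto)
  then show False using z assms(3) by simp
qed

text \<open>A certificate says that the quantile is at most \<alpha>, so the Beta distribution
  function has already reached 1 - \<gamma> at \<alpha>; its complement is the binomial tail at
  \<alpha>.\<close>

lemma binomial_cdf_le_if_clopper_pearson_le:
  assumes "k \<le> n" "0 < \<gamma>" "0 \<le> \<alpha>" "\<alpha> < 1" "clopper_pearson k n \<gamma> \<le> \<alpha>"
  shows "k < n" "binomial_cdf n k \<alpha> \<le> \<gamma>"
proof -
  let ?B = "beta_distribution (real k + 1) (real n - real k)"
  \<comment> \<open>In the degenerate cases n = 0 and k = n the bound is 1, which exceeds \<alpha>;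
    only the Beta branch can certify.\<close>
  show k: "k < n"
    using assms by (auto simp: clopper_pearson_def split: if_splits)
  have "real_distribution ?B"
    by (intro real_distribution.intro prob_space_beta_distribution[OF k] real_distribution_axioms.intro) simp
  moreover have "1 - \<gamma> \<le> cdf ?B 1"
    using cdf_beta_distribution[OF k, of 1] binomial_cdf_1[OF k] assms by simp
  moreover have "quantile ?B (1 - \<gamma>) \<le> \<alpha>"
    using k assms by (simp add: clopper_pearson_def)
  ultimately have "1 - \<gamma> \<le> cdf ?B \<alpha>" by (rule le_cdf_if_quantile_le)
  then show "binomial_cdf n k \<alpha> \<le> \<gamma>"
    using cdf_beta_distribution[OF k, of \<alpha>] assms by simp
qed

text \<open>The counts with \<open>U(k, n; \<gamma>) \<le> \<alpha>\<close> all lie below the largest of them, so their total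
  probability is a lower tail, which decreases in \<open>p\<close>.\<close>

lemma binomial_clopper_pearson:
  assumes "0 < \<gamma>" "0 \<le> \<alpha>" "\<alpha> < p" "p \<le> 1"
  shows "(\<Sum>k\<in>{k. k \<le> n \<and> clopper_pearson k n \<gamma> \<le> \<alpha>}.
    real (n choose k) * p ^ k * (1 - p) ^ (n - k)) \<le> \<gamma>"
proof (cases "{k. k \<le> n \<and> clopper_pearson k n \<gamma> \<le> \<alpha>} = {}")
  case True
  then show ?thesis using assms(1) by (simp only: sum.empty)
next
  case False
  define m where "m = Max {k. k \<le> n \<and> clopper_pearson k n \<gamma> \<le> \<alpha>}"
  have m: "m \<le> n" "clopper_pearson m n \<gamma> \<le> \<alpha>"
    using Max_in[OF _ False] by (auto simp: m_def)
  have sub: "{k. k \<le> n \<and> clopper_pearson k n \<gamma> \<le> \<alpha>} \<subseteq> {..m}"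
    by (auto simp: m_def)
  have less: "m < n" "binomial_cdf n m \<alpha> \<le> \<gamma>"
    using binomial_cdf_le_if_clopper_pearson_le[of m n \<gamma> \<alpha>] m assms by auto
  have "(\<Sum>k\<in>{k. k \<le> n \<and> clopper_pearson k n \<gamma> \<le> \<alpha>}.
      real (n choose k) * p ^ k * (1 - p) ^ (n - k)) \<le> binomial_cdf n m p"
    unfolding binomial_cdf_def using sub assms by (intro sum_mono2) auto
  also have "\<dots> \<le> binomial_cdf n m \<alpha>"
    using less assms by (intro binomial_cdf_antimono) auto
  finally show ?thesis using less by simp
qed

text \<open>Grouping the subsets by size produces the binomial coefficients. This passes from the
  positions of the incidents to their number.\<close>

lemma sum_over_card_subsets:
  fixes w :: "nat \<Rightarrow> 'b::comm_semiring_1"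
  assumes "finite S"
  shows "(\<Sum>T | T \<subseteq> S \<and> Q (card T). w (card T))
    = (\<Sum>k | k \<le> card S \<and> Q k. of_nat (card S choose k) * w k)"
proof -
  have "(\<Sum>T | T \<subseteq> S \<and> Q (card T). w (card T)) =
    (\<Sum>k | k \<le> card S \<and> Q k. \<Sum>T\<in>{T \<in> {T. T \<subseteq> S \<and> Q (card T)}. card T = k}. w (card T))"
    using assms by (intro sum.group[symmetric]) (auto intro: card_mono)
  also have "\<dots> = (\<Sum>k | k \<le> card S \<and> Q k. of_nat (card S choose k) * w k)"
  proof (intro sum.cong refl)
    fix k assume "k \<in> {k. k \<le> card S \<and> Q k}"
    then have "{T \<in> {T. T \<subseteq> S \<and> Q (card T)}. card T = k} = {T. T \<subseteq> S \<and> card T = k}" by auto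
    then show "(\<Sum>T\<in>{T \<in> {T. T \<subseteq> S \<and> Q (card T)}. card T = k}. w (card T))
        = of_nat (card S choose k) * w k"
      using n_subsets[OF assms, of k] by simp
  qed
  finally show ?thesis .
qed


section \<open>Sampling from a fixed distribution\<close>

text \<open>The blocks stand for units with an incident (T), selected units without one (S - T) and
  unselected units (I - S). Independence turns the box into a product that is constant on each
  block.\<close>

lemma measure_PiM_PiE_three_way:
  assumes "finite I" "prob_space D" "T \<subseteq> S" "S \<subseteq> I" "A \<in> sets D" "B \<in> sets D" "C \<in> sets D"
  shows "measure (\<Pi>\<^sub>M i\<in>I. D) (\<Pi>\<^sub>E i\<in>I. if i \<in> T then A else if i \<in> S then B else C)
    = measure D A ^ card T * measure D B ^ (card S - card T) * measure D C ^ card (I - S)"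
proof -
  interpret D: prob_space D by fact
  interpret finite_product_prob_space "\<lambda>_. D" I by standard (rule assms(1))
  have fin: "finite S" "finite T"
    using assms by (auto intro: finite_subset)
  have "measure (\<Pi>\<^sub>M i\<in>I. D) (\<Pi>\<^sub>E i\<in>I. if i \<in> T then A else if i \<in> S then B else C)
    = (\<Prod>i\<in>I. measure D (if i \<in> T then A else if i \<in> S then B else C))"
    using assms by (intro prob_times) auto
  also have "\<dots> = (\<Prod>i\<in>I. if i \<in> T then measure D A else if i \<in> S then measure D B else measure D C)"
    by (intro prod.cong) auto
  also have "\<dots> = measure D A ^ card (I \<inter> T) * (measure D B ^ card (I \<inter> - T \<inter> S)
      * measure D C ^ card (I \<inter> - T \<inter> - S))"
    using assms(1) by (simp add: prod.If_cases)
  also have "I \<inter> T = T"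
    using assms by auto
  also have "I \<inter> - T \<inter> S = S - T"
    using assms by auto
  also have "I \<inter> - T \<inter> - S = I - S"
    using assms by auto
  finally show ?thesis
    using assms fin by (simp add: card_Diff_subset mult_ac)
qed

text \<open>Splitting by the set \<open>S\<close> of selected units and the set \<open>T\<close> of incidents among them makes the
  number of incidents binomial given the number of selected units.\<close>

lemma measure_PiM_clopper_pearson_le:
  fixes sel inc :: "'z \<Rightarrow> bool"
  assumes I: "finite I" and D: "prob_space D"
    and [measurable]: "Measurable.pred D sel" "Measurable.pred D inc"
    and \<gamma>: "0 < \<gamma>" and \<alpha>: "0 \<le> \<alpha>" "\<alpha> < R" "R \<le> 1"
    and R: "\<P>(z in D. sel z) \<noteq> 0 \<longrightarrow> R = \<P>(z in D. inc z \<bar> sel z)"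
  shows "measure (\<Pi>\<^sub>M i\<in>I. D) {z \<in> space (\<Pi>\<^sub>M i\<in>I. D).
    clopper_pearson (\<Sum>i\<in>I. of_bool (sel (z i) \<and> inc (z i))) (\<Sum>i\<in>I. of_bool (sel (z i))) \<gamma> \<le> \<alpha>} \<le> \<gamma>"
    (is "measure ?Q ?E \<le> \<gamma>")
proof -
  interpret D: prob_space D by fact
  interpret Q: finite_product_prob_space "\<lambda>_. D" I by standard (rule I)
  define A where "A = {z \<in> space D. sel z \<and> inc z}"
  define B where "B = {z \<in> space D. sel z \<and> \<not> inc z}"
  define C where "C = {z \<in> space D. \<not> sel z}"
  have sets [measurable]: "A \<in> sets D" "B \<in> sets D" "C \<in> sets D"
    unfolding A_def B_def C_def by measurable
  define s where "s = \<P>(z in D. sel z)"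
  have s: "0 \<le> s" "s \<le> 1" by (auto simp: s_def)
  have "s = measure D (A \<union> B)"
    by (auto simp: s_def A_def B_def intro: arg_cong[where f = "measure D"])
  also have "\<dots> = measure D A + measure D B"
    by (rule D.finite_measure_Union) (auto simp: A_def B_def)
  finally have AB: "s = measure D A + measure D B" .
  \<comment> \<open>If selection has probability 0, then R is an arbitrary value, but the identity
    persists because \<open>A\<close> and \<open>B\<close> are both null.\<close>
  have mA: "measure D A = R * s"
  proof (cases "s = 0")
    case True
    then show ?thesis using AB measure_nonneg[of D A] measure_nonneg[of D B] by (metis add_nonneg_eq_0_iff mult_zero_right)
  next
    case False
    then have "R = measure D A / s"
      using R by (simp add: cond_prob_def s_def A_def conj_commute)
    then show ?thesis using False by simp
  qed
  have mB: "measure D B = (1 - R) * s"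
    using AB mA by (simp add: algebra_simps)
  have "C = space D - (A \<union> B)" by (auto simp: A_def B_def C_def)
  then have mC: "measure D C = 1 - s"
    using D.prob_compl[of "A \<union> B"] \<open>s = measure D (A \<union> B)\<close> by simp
  \<comment> \<open>For a pattern in \<open>J\<close>, \<open>X S T\<close> is the box of samples
    that select exactly the units in S and have incidents exactly at T among them. \<open>J\<close>
    collects the patterns whose counts pass the certificate.\<close>
  define X where "X = (\<lambda>S T. \<Pi>\<^sub>E i\<in>I. if i \<in> T then A else if i \<in> S then B else C)"
  define J where "J = (SIGMA S:Pow I. {T. T \<subseteq> S \<and> clopper_pearson (card T) (card S) \<gamma> \<le> \<alpha>})"
  have fin: "finite {T. T \<subseteq> S \<and> clopper_pearson (card T) (card S) \<gamma> \<le> \<alpha>}" if "S \<in> Pow I" for S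
    using that I by (rule_tac finite_subset[where B = "Pow I"]) auto
  have J: "finite J"
    unfolding J_def by (rule finite_SigmaI[OF finite_Pow_iff[THEN iffD2, OF I] fin])
  have X [measurable]: "X S T \<in> sets ?Q" for S T
    unfolding X_def using I by (intro sets_PiM_I_finite) auto
  have "?E \<subseteq> (\<Union>(S, T)\<in>J. X S T)"
  proof
    fix z assume z: "z \<in> ?E"
    define S where "S = {i \<in> I. sel (z i)}"
    define T where "T = {i \<in> I. sel (z i) \<and> inc (z i)}"
    have "(\<Sum>i\<in>I. of_bool (sel (z i) \<and> inc (z i))) = card T" "(\<Sum>i\<in>I. of_bool (sel (z i))) = card S"
      using I by (simp_all add: S_def T_def Int_def)
    then have "(S, T) \<in> J"
      using z by (auto simp: J_def S_def T_def)
    moreover have "z \<in> space ?Q" using z by blast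
    then have zD: "z \<in> extensional I" "\<And>i. i \<in> I \<Longrightarrow> z i \<in> space D"
      by (simp_all add: space_PiM PiE_iff)
    have "z \<in> X S T"
      unfolding X_def
    proof (rule PiE_I)
      fix i assume i: "i \<in> I"
      then show "z i \<in> (if i \<in> T then A else if i \<in> S then B else C)"
        using zD(2)[OF i] unfolding S_def T_def A_def B_def C_def
        by (cases "sel (z i)"; cases "inc (z i)") simp_all
    qed (use zD(1) in \<open>auto simp: extensional_def\<close>)
    ultimately show "z \<in> (\<Union>(S, T)\<in>J. X S T)" by blast
  qed
  then have "measure ?Q ?E \<le> measure ?Q (\<Union>(S, T)\<in>J. X S T)"
    using J by (intro Q.finite_measure_mono sets.finite_UN) auto
  \<comment> \<open>Nothing is lost here: boxes of distinct patterns are disjoint.\<close>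
  also have "\<dots> \<le> (\<Sum>(S, T)\<in>J. measure ?Q (X S T))"
    using measure_UNION_le[OF J, of "\<lambda>(S, T). X S T" ?Q] by (simp add: case_prod_unfold)
  also have "\<dots> = (\<Sum>S\<in>Pow I. \<Sum>T | T \<subseteq> S \<and> clopper_pearson (card T) (card S) \<gamma> \<le> \<alpha>. measure ?Q (X S T))"
    unfolding J_def using I fin by (subst sum.Sigma) simp_all
  \<comment> \<open>For fixed S the box weights factor into the probability that exactly S is
    selected and binomial weights with parameters |S| and R. The latter contribute at most \<gamma>
    over the certifying counts.\<close>
  also have "\<dots> \<le> (\<Sum>S\<in>Pow I. s ^ card S * (1 - s) ^ card (I - S) * \<gamma>)"
  proof (rule sum_mono)
    fix S assume "S \<in> Pow I"
    then have S: "S \<subseteq> I" "finite S" using I by (auto intro: finite_subset)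
    have "(\<Sum>T | T \<subseteq> S \<and> clopper_pearson (card T) (card S) \<gamma> \<le> \<alpha>. measure ?Q (X S T)) =
      (\<Sum>T | T \<subseteq> S \<and> clopper_pearson (card T) (card S) \<gamma> \<le> \<alpha>.
        s ^ card S * (1 - s) ^ card (I - S) * (R ^ card T * (1 - R) ^ (card S - card T)))"
    proof (rule sum.cong[OF refl], clarify)
      fix T assume "T \<subseteq> S"
      then have le: "card T \<le> card S" using S by (auto intro: card_mono)
      then have sp: "s ^ card S = s ^ card T * s ^ (card S - card T)"
        by (simp flip: power_add)
      show "measure ?Q (X S T) =
          s ^ card S * (1 - s) ^ card (I - S) * (R ^ card T * (1 - R) ^ (card S - card T))"
        unfolding X_def measure_PiM_PiE_three_way[OF I D \<open>T \<subseteq> S\<close> S(1) sets] mA mB mC sp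
          power_mult_distrib by (simp only: mult_ac)
    qed
    also have "\<dots> = s ^ card S * (1 - s) ^ card (I - S) *
      (\<Sum>k\<in>{k. k \<le> card S \<and> clopper_pearson k (card S) \<gamma> \<le> \<alpha>}.
        real (card S choose k) * R ^ k * (1 - R) ^ (card S - k))"
      using sum_over_card_subsets[OF S(2), of "\<lambda>k. R ^ k * (1 - R) ^ (card S - k)"
          "\<lambda>k. clopper_pearson k (card S) \<gamma> \<le> \<alpha>"]
      by (simp flip: sum_distrib_left add: mult.assoc)
    also have "\<dots> \<le> s ^ card S * (1 - s) ^ card (I - S) * \<gamma>"
      using s binomial_clopper_pearson[OF \<gamma> \<alpha>] by (intro mult_left_mono) auto
    finally show "(\<Sum>T | T \<subseteq> S \<and> clopper_pearson (card T) (card S) \<gamma> \<le> \<alpha>. measure ?Q (X S T))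
      \<le> s ^ card S * (1 - s) ^ card (I - S) * \<gamma>" .
  qed
  \<comment> \<open>The selection probabilities add up to 1: they are the expansion of the product
    of s + (1 - s) over I.\<close>
  also have "\<dots> = \<gamma>"
    using prod_add[OF I, of "\<lambda>_. s" "\<lambda>_. 1 - s"] by (simp flip: sum_distrib_right)
  finally show ?thesis .
qed

section \<open>Law of the sample, and freezing of the pre-certification information\<close>

lemma distr_cond_iid:
  assumes "prob_space P" "subalgebra P F" "prob_space D" "finite I" "cond_iid P F D I Z"
  shows "distr P (\<Pi>\<^sub>M i\<in>I. D) (\<lambda>\<omega>. \<lambda>i\<in>I. Z i \<omega>) = (\<Pi>\<^sub>M i\<in>I. D)"
proof -
  interpret P: prob_space P by fact
  interpret D: prob_space D by fact
  interpret Q: finite_product_prob_space "\<lambda>_. D" I by standard (rule assms(4))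
  interpret F: finite_measure_subalgebra P F by standard (rule assms(2))
  have Z: "Z i \<in> P \<rightarrow>\<^sub>M D" if "i \<in> I" for i
    using assms(5) that by (simp add: cond_iid_def)
  have ZQ: "(\<lambda>\<omega>. \<lambda>i\<in>I. Z i \<omega>) \<in> P \<rightarrow>\<^sub>M (\<Pi>\<^sub>M i\<in>I. D)"
    by (rule measurable_restrict) (rule Z)
  show ?thesis
  proof (rule Q.PiM_eqI[OF assms(4)])
    fix A assume A: "\<And>i. i \<in> I \<Longrightarrow> A i \<in> sets D"
    let ?E = "{\<omega>\<in>space P. \<forall>i\<in>I. Z i \<omega> \<in> A i}"
    have E: "(\<lambda>\<omega>. \<lambda>i\<in>I. Z i \<omega>) -` (Pi\<^sub>E I A) \<inter> space P = ?E"
      by (auto simp: PiE_iff)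
    have meas: "Pi\<^sub>E I A \<in> sets (\<Pi>\<^sub>M i\<in>I. D)"
      using A assms(4) by (intro sets_PiM_I_finite) auto
    have Es: "?E \<in> sets P"
      using measurable_sets[OF ZQ meas] E by simp
    \<comment> \<open>Averaging the conditional product formula over \<open>P\<close> gives the
      unconditional one, and boxes determine the product measure.\<close>
    have "measure P ?E = (\<integral>\<omega>. indicat_real ?E \<omega> \<partial>P)"
      using Es by (simp add: Int_absorb1 sets.sets_into_space)
    also have "\<dots> = (\<integral>\<omega>. real_cond_exp P F (indicat_real ?E) \<omega> \<partial>P)"
      using Es by (intro F.real_cond_exp_int(2)[symmetric]) (simp add: P.emeasure_eq_measure)
    also have "\<dots> = (\<integral>\<omega>. (\<Prod>i\<in>I. measure D (A i)) \<partial>P)"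
      using assms(5) A by (intro integral_cong_AE) (auto simp: cond_iid_def)
    also have "\<dots> = (\<Prod>i\<in>I. measure D (A i))"
      by (simp add: P.prob_space)
    finally have "measure P ?E = (\<Prod>i\<in>I. measure D (A i))" .
    then show "emeasure (distr P (\<Pi>\<^sub>M i\<in>I. D) (\<lambda>\<omega>. \<lambda>i\<in>I. Z i \<omega>)) (Pi\<^sub>E I A) = (\<Prod>i\<in>I. emeasure D (A i))"
      using emeasure_distr[OF ZQ meas] E
      by (simp add: P.emeasure_eq_measure D.emeasure_eq_measure prod_ennreal)
  qed simp
qed

text \<open>Rectangles determine the joint law, and on them independence is the product formula. The
  first marginal is the identity viewed as a map into \<open>F\<close>, hence \<open>P\<close>
  restricted to \<open>F\<close>.\<close>

lemma distr_Pair_indep: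
  assumes "prob_space P" "subalgebra P F" and X: "X \<in> P \<rightarrow>\<^sub>M Q"
    and indep: "prob_space.indep_set P (sets F) (sets (vimage_algebra (space P) X Q))"
  shows "distr P (F \<Otimes>\<^sub>M Q) (\<lambda>\<omega>. (\<omega>, X \<omega>)) = restr_to_subalg P F \<Otimes>\<^sub>M distr P Q X"
proof -
  interpret P: prob_space P by fact
  interpret X: prob_space "distr P Q X" by (rule P.prob_space_distr[OF X])
  interpret R: prob_space "restr_to_subalg P F"
    by (rule prob_space_restr_to_subalg[OF assms(2,1)])
  have id: "(\<lambda>\<omega>. \<omega>) \<in> P \<rightarrow>\<^sub>M F"
    using measurable_from_subalg[OF assms(2), of "\<lambda>\<omega>. \<omega>" F] by simp
  have PX: "(\<lambda>\<omega>. (\<omega>, X \<omega>)) \<in> P \<rightarrow>\<^sub>M F \<Otimes>\<^sub>M Q"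
    by (rule measurable_Pair[OF id X])
  show ?thesis
  proof (rule pair_measure_eqI[symmetric])
    show "sets (restr_to_subalg P F \<Otimes>\<^sub>M distr P Q X) = sets (distr P (F \<Otimes>\<^sub>M Q) (\<lambda>\<omega>. (\<omega>, X \<omega>)))"
      using assms(2) by (simp add: sets_restr_to_subalg cong: sets_pair_measure_cong)
    fix A B assume "A \<in> sets (restr_to_subalg P F)" "B \<in> sets (distr P Q X)"
    then have A: "A \<in> sets F" and B: "B \<in> sets Q"
      using assms(2) by (simp_all add: sets_restr_to_subalg)
    have "X -` B \<inter> space P \<in> sets (vimage_algebra (space P) X Q)"
      by (rule in_vimage_algebra[OF B])
    with indep A have "measure P (A \<inter> (X -` B \<inter> space P)) = measure P A * measure P (X -` B \<inter> space P)"
      by (rule P.indep_setD)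
    moreover have "(\<lambda>\<omega>. (\<omega>, X \<omega>)) -` (A \<times> B) \<inter> space P = A \<inter> (X -` B \<inter> space P)"
      by auto
    ultimately show "emeasure (restr_to_subalg P F) A * emeasure (distr P Q X) B
      = emeasure (distr P (F \<Otimes>\<^sub>M Q) (\<lambda>\<omega>. (\<omega>, X \<omega>))) (A \<times> B)"
      using A B emeasure_distr[OF PX pair_measureI[OF A B]] emeasure_distr[OF X B]
        emeasure_restr_to_subalg[OF assms(2) A]
      by (simp add: P.emeasure_eq_measure ennreal_mult)
  qed (intro R.sigma_finite_measure_axioms X.sigma_finite_measure_axioms)+
qed

text \<open>The hypothesis on the joint law says that \<open>X\<close> has law \<open>Q\<close> and is independent of \<open>F\<close>.\<close>

lemma real_cond_exp_freezing:
  assumes "prob_space P" "subalgebra P F" "prob_space Q" and X: "X \<in> P \<rightarrow>\<^sub>M Q"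
    and distr: "distr P (F \<Otimes>\<^sub>M Q) (\<lambda>\<omega>. (\<omega>, X \<omega>)) = restr_to_subalg P F \<Otimes>\<^sub>M Q"
    and H: "H \<in> sets (F \<Otimes>\<^sub>M Q)"
  defines "E \<equiv> {\<omega> \<in> space P. (\<omega>, X \<omega>) \<in> H}"
  shows "E \<in> sets P"
    and "AE \<omega> in P. real_cond_exp P F (indicat_real E) \<omega> = measure Q (Pair \<omega> -` H)"
proof -
  interpret P: prob_space P by fact
  interpret Q: prob_space Q by fact
  interpret F: finite_measure_subalgebra P F by standard (rule assms(2))
  have id: "(\<lambda>\<omega>. \<omega>) \<in> P \<rightarrow>\<^sub>M F"
    using measurable_from_subalg[OF assms(2), of "\<lambda>\<omega>. \<omega>" F] by simp
  have PX: "(\<lambda>\<omega>. (\<omega>, X \<omega>)) \<in> P \<rightarrow>\<^sub>M F \<Otimes>\<^sub>M Q"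
    by (rule measurable_Pair[OF id X])
  have E_eq: "E = (\<lambda>\<omega>. (\<omega>, X \<omega>)) -` H \<inter> space P"
    by (auto simp: E_def)
  show E [measurable]: "E \<in> sets P"
    unfolding E_eq by (rule measurable_sets[OF PX H])
  let ?g = "\<lambda>\<omega>. measure Q (Pair \<omega> -` H)"
  have gF [measurable]: "?g \<in> borel_measurable F"
    unfolding measure_def using Q.measurable_emeasure_Pair[OF H] by simp
  then have gP [measurable]: "?g \<in> borel_measurable P"
    by (rule measurable_from_subalg[OF assms(2)])
  have gi: "integrable P ?g"
    by (rule P.integrable_const_bound[where B = 1]) auto
  show "AE \<omega> in P. real_cond_exp P F (indicat_real E) \<omega> = ?g \<omega>"
  proof (rule F.real_cond_exp_charact[OF _ _ gi gF])
    fix A assume A: "A \<in> sets F"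
    then have AP [measurable]: "A \<in> sets P" using assms(2) by (auto simp: subalgebra_def)
    \<comment> \<open>Cutting \<open>H\<close> down to the cylinder over the test set A lets one
      Fubini computation evaluate the integral over A.\<close>
    let ?H = "H \<inter> A \<times> space Q"
    have H': "?H \<in> sets (F \<Otimes>\<^sub>M Q)" using A H by auto
    have spR: "sets (restr_to_subalg P F \<Otimes>\<^sub>M Q) = sets (F \<Otimes>\<^sub>M Q)"
      using assms(2) by (simp add: sets_restr_to_subalg cong: sets_pair_measure_cong)
    have "emeasure P (E \<inter> A) = emeasure (distr P (F \<Otimes>\<^sub>M Q) (\<lambda>\<omega>. (\<omega>, X \<omega>))) ?H"
    proof -
      have "E \<inter> A = (\<lambda>\<omega>. (\<omega>, X \<omega>)) -` ?H \<inter> space P"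
        using measurable_space[OF X] by (auto simp: E_def)
      then show ?thesis using emeasure_distr[OF PX H'] by simp
    qed
    also have "\<dots> = (\<integral>\<^sup>+ \<omega>. emeasure Q (Pair \<omega> -` ?H) \<partial>restr_to_subalg P F)"
      unfolding distr using H' spR by (intro Q.emeasure_pair_measure_alt) simp
    \<comment> \<open>The section measure is \<open>F\<close>-measurable, so its integrals under
      \<open>P\<close> and under the restriction of \<open>P\<close> agree.\<close>
    also have "\<dots> = (\<integral>\<^sup>+ \<omega>. emeasure Q (Pair \<omega> -` ?H) \<partial>P)"
      using Q.measurable_emeasure_Pair[OF H'] by (intro nn_integral_subalgebra2 assms(2)) auto
    also have "\<dots> = (\<integral>\<^sup>+ \<omega>. ennreal (?g \<omega> * indicator A \<omega>) \<partial>P)"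
    proof (rule nn_integral_cong)
      fix \<omega>
      have "Pair \<omega> -` ?H = (if \<omega> \<in> A then Pair \<omega> -` H else {})"
        using sets.sets_into_space[OF H] by (auto simp: space_pair_measure)
      then show "emeasure Q (Pair \<omega> -` ?H) = ennreal (?g \<omega> * indicator A \<omega>)"
        by (auto simp: Q.emeasure_eq_measure)
    qed
    also have "\<dots> = ennreal (\<integral>\<omega>. ?g \<omega> * indicator A \<omega> \<partial>P)"
      using gi by (intro nn_integral_eq_integral integrable_real_mult_indicator) auto
    finally have "ennreal (measure P (E \<inter> A)) = ennreal (\<integral>\<omega>. ?g \<omega> * indicator A \<omega> \<partial>P)"
      by (simp add: P.emeasure_eq_measure)
    then have "measure P (E \<inter> A) = (\<integral>\<omega>. ?g \<omega> * indicator A \<omega> \<partial>P)"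
      by (simp add: Bochner_Integration.integral_nonneg)
    moreover have "(\<integral>\<omega>\<in>A. indicat_real E \<omega> \<partial>P) = measure P (E \<inter> A)"
      using E AP sets.sets_into_space[OF AP]
      by (simp add: set_lebesgue_integral_def Int_absorb1 Int_absorb2 Int_commute le_infI2 flip: indicator_inter_arith)
    ultimately show "(\<integral>\<omega>\<in>A. indicat_real E \<omega> \<partial>P) = (\<integral>\<omega>\<in>A. ?g \<omega> \<partial>P)"
      by (simp add: set_lebesgue_integral_def mult.commute)
  qed (simp add: P.emeasure_eq_measure E)
qed


section \<open>Measurability of a random policy\<close>

lemma measurable_vec_nth [measurable (raw)]:
  fixes f :: "'a \<Rightarrow> real ^ 'n::finite"
  assumes "f \<in> borel_measurable M"
  shows "(\<lambda>x. f x $ i) \<in> borel_measurable M"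
  by (rule borel_measurable_continuous_onI[THEN measurable_compose[OF assms]])
    (intro continuous_intros)

text \<open>With at least one action the minimum is attained, so \<open>LEAST\<close> ranges over a
  nonempty set. Policies are known to be measurable only at these indices.\<close>

lemma selected_index_in_range:
  assumes "K \<ge> 1"
  shows "selected_index \<alpha>\<^sub>l \<alpha>\<^sub>a K p x \<in> {1..K}"
proof -
  have "q_star \<alpha>\<^sub>l \<alpha>\<^sub>a K p x \<in> (\<lambda>k. q_score \<alpha>\<^sub>l \<alpha>\<^sub>a p k x) ` {1..K}"
    unfolding q_star_def using assms by (intro Min_in) auto
  then obtain k where "k \<in> {1..K} \<and> q_score \<alpha>\<^sub>l \<alpha>\<^sub>a p k x = q_star \<alpha>\<^sub>l \<alpha>\<^sub>a K p x"
    by auto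
  from LeastI[where P = "\<lambda>k. k \<in> {1..K} \<and> q_score \<alpha>\<^sub>l \<alpha>\<^sub>a p k x = q_star \<alpha>\<^sub>l \<alpha>\<^sub>a K p x", OF this]
  show ?thesis unfolding selected_index_def by blast
qed

context
  fixes F :: "'a measure" and SX :: "'x measure" and K :: nat
    and \<pi> :: "'a \<Rightarrow> ('x, 'h::finite, 'w::finite) policy"
  assumes \<pi>: "policy_measurable F SX K \<pi>" and K: "K \<ge> 1"
begin

lemma measurable_policy_q_score:
  assumes "k \<in> {1..K}"
  shows "(\<lambda>(\<omega>, x). q_score \<alpha>\<^sub>l \<alpha>\<^sub>a (\<pi> \<omega>) k x) \<in> borel_measurable (F \<Otimes>\<^sub>M SX)"
proof -
  have [measurable]: "(\<lambda>(\<omega>, x). score_loss (\<pi> \<omega>) k x) \<in> borel_measurable (F \<Otimes>\<^sub>M SX)"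
    "(\<lambda>(\<omega>, x). score_act (\<pi> \<omega>) k x) \<in> borel_measurable (F \<Otimes>\<^sub>M SX)"
    using \<pi> assms by (auto simp: policy_measurable_def)
  show ?thesis unfolding q_score_def by measurable
qed

lemma measurable_policy_q_star:
  "(\<lambda>(\<omega>, x). q_star \<alpha>\<^sub>l \<alpha>\<^sub>a K (\<pi> \<omega>) x) \<in> borel_measurable (F \<Otimes>\<^sub>M SX)"
  using borel_measurable_Min[of "{1..K}" "\<lambda>k (\<omega>, x). q_score \<alpha>\<^sub>l \<alpha>\<^sub>a (\<pi> \<omega>) k x" "F \<Otimes>\<^sub>M SX"]
    measurable_policy_q_score
  by (simp add: q_star_def case_prod_unfold)

lemma measurable_policy_gate:
  "Measurable.pred (F \<Otimes>\<^sub>M SX) (\<lambda>(\<omega>, x). gate \<alpha>\<^sub>l \<alpha>\<^sub>a K (\<pi> \<omega>) x)"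
proof -
  note [measurable] = measurable_policy_q_star
  have [measurable]: "(\<lambda>\<omega>. gate_threshold (\<pi> \<omega>)) \<in> borel_measurable F"
    using \<pi> by (simp add: policy_measurable_def)
  show ?thesis unfolding gate_def by measurable
qed

text \<open>A least natural number satisfying measurable predicates is measurable; indices out of
  range contribute the constant predicate False. The codomain is then cut down to
  \<open>{1..K}\<close> so that composition involves genuine actions only.\<close>

lemma measurable_policy_selected_index:
  "(\<lambda>(\<omega>, x). selected_index \<alpha>\<^sub>l \<alpha>\<^sub>a K (\<pi> \<omega>) x) \<in> F \<Otimes>\<^sub>M SX \<rightarrow>\<^sub>M count_space {1..K}"
proof -
  have "Measurable.pred (F \<Otimes>\<^sub>M SX) (\<lambda>(\<omega>, x).
    k \<in> {1..K} \<and> q_score \<alpha>\<^sub>l \<alpha>\<^sub>a (\<pi> \<omega>) k x = q_star \<alpha>\<^sub>l \<alpha>\<^sub>a K (\<pi> \<omega>) x)" for k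
  proof (cases "k \<in> {1..K}")
    case True
    note [measurable] = measurable_policy_q_score[OF True] measurable_policy_q_star
    show ?thesis by measurable
  next
    case False
    then have "(\<lambda>(\<omega>, x). k \<in> {1..K} \<and> q_score \<alpha>\<^sub>l \<alpha>\<^sub>a (\<pi> \<omega>) k x = q_star \<alpha>\<^sub>l \<alpha>\<^sub>a K (\<pi> \<omega>) x) = (\<lambda>_. False)"
      by auto
    then show ?thesis by (simp only: measurable_const UNIV_I space_count_space)
  qed
  then have "(\<lambda>\<omega>x. LEAST k. (\<lambda>(\<omega>, x).
      k \<in> {1..K} \<and> q_score \<alpha>\<^sub>l \<alpha>\<^sub>a (\<pi> \<omega>) k x = q_star \<alpha>\<^sub>l \<alpha>\<^sub>a K (\<pi> \<omega>) x) \<omega>x)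
      \<in> F \<Otimes>\<^sub>M SX \<rightarrow>\<^sub>M count_space UNIV"
    by (rule measurable_Least)
  then have "(\<lambda>(\<omega>, x). selected_index \<alpha>\<^sub>l \<alpha>\<^sub>a K (\<pi> \<omega>) x) \<in> F \<Otimes>\<^sub>M SX \<rightarrow>\<^sub>M count_space UNIV"
    by (simp only: selected_index_def case_prod_unfold)
  then have "(\<lambda>(\<omega>, x). selected_index \<alpha>\<^sub>l \<alpha>\<^sub>a K (\<pi> \<omega>) x)
      \<in> F \<Otimes>\<^sub>M SX \<rightarrow>\<^sub>M restrict_space (count_space UNIV) {1..K}"
    by (rule measurable_restrict_space2[rotated])
      (auto simp only: case_prod_unfold intro!: Pi_I selected_index_in_range[OF K])
  then show ?thesis by (simp add: restrict_count_space)
qed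

lemma measurable_policy_a_star:
  "(\<lambda>(\<omega>, x). a_star \<alpha>\<^sub>l \<alpha>\<^sub>a K (\<pi> \<omega>) x) \<in> borel_measurable (F \<Otimes>\<^sub>M SX)"
proof -
  have "(\<lambda>(\<omega>, x). action (\<pi> \<omega>) k x) \<in> borel_measurable (F \<Otimes>\<^sub>M SX)" if "k \<in> {1..K}" for k
    using \<pi> that by (auto simp: policy_measurable_def)
  with measurable_compose_countable'[where f = "\<lambda>k (\<omega>, x). action (\<pi> \<omega>) k x",
      OF _ measurable_policy_selected_index]
  show ?thesis by (simp add: a_star_def case_prod_unfold)
qed

text \<open>The displayed image depends on the outcome too, so the composition relies on the joint
  measurability of the detector in outcome and image.\<close>

lemma measurable_policy_detector_a_star:
  "(\<lambda>(\<omega>, x). detector (\<pi> \<omega>) (a_star \<alpha>\<^sub>l \<alpha>\<^sub>a K (\<pi> \<omega>) x)) \<in> borel_measurable (F \<Otimes>\<^sub>M SX)"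
proof -
  note [measurable] = measurable_policy_a_star
  have det: "(\<lambda>(\<omega>, y). detector (\<pi> \<omega>) y) \<in> borel_measurable (F \<Otimes>\<^sub>M borel)"
    using \<pi> by (simp add: policy_measurable_def)
  have "(\<lambda>(\<omega>, x). (\<omega>, a_star \<alpha>\<^sub>l \<alpha>\<^sub>a K (\<pi> \<omega>) x)) \<in> F \<Otimes>\<^sub>M SX \<rightarrow>\<^sub>M F \<Otimes>\<^sub>M borel"
    by measurable
  from measurable_compose[OF this det] show ?thesis by (simp add: case_prod_unfold)
qed

section \<open>Selections and incidents as events on outcomes and units\<close>

context
  fixes D :: "('x \<times> ('h, 'w) mask) measure"
  assumes D: "sets D = sets (unit_space SX)"
begin

lemma measurable_unit_mask: "Measurable.pred D (\<lambda>z. Q (snd z))"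
proof -
  have "Measurable.pred (unit_space SX) (\<lambda>z. Q (snd z))"
    unfolding unit_space_def by (rule measurable_compose[OF measurable_snd, of Q]) simp
  then show ?thesis by (simp add: measurable_cong_sets[OF D refl])
qed

lemma measurable_unit_image: "fst \<in> D \<rightarrow>\<^sub>M SX"
proof -
  have "fst \<in> unit_space SX \<rightarrow>\<^sub>M SX"
    unfolding unit_space_def by measurable
  then show ?thesis by (simp add: measurable_cong_sets[OF D refl])
qed

lemma measurable_unit_of_policy:
  assumes "(\<lambda>(\<omega>, x). f \<omega> x) \<in> F \<Otimes>\<^sub>M SX \<rightarrow>\<^sub>M N"
  shows "(\<lambda>(\<omega>, z). f \<omega> (fst z)) \<in> F \<Otimes>\<^sub>M D \<rightarrow>\<^sub>M N"
proof -
  note [measurable] = measurable_unit_image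
  have "(\<lambda>(\<omega>, z). (\<omega>, fst z)) \<in> F \<Otimes>\<^sub>M D \<rightarrow>\<^sub>M F \<Otimes>\<^sub>M SX" by measurable
  from measurable_compose[OF this assms] show ?thesis by (simp add: case_prod_unfold)
qed

lemma measurable_policy_loss_selected:
  "Measurable.pred (F \<Otimes>\<^sub>M D) (\<lambda>(\<omega>, x, m). gate \<alpha>\<^sub>l \<alpha>\<^sub>a K (\<pi> \<omega>) x \<and> positive_mask m)"
proof -
  note [measurable] = measurable_unit_of_policy[OF measurable_policy_gate]
    measurable_unit_mask[of positive_mask]
  have "Measurable.pred (F \<Otimes>\<^sub>M D) (\<lambda>(\<omega>, z). gate \<alpha>\<^sub>l \<alpha>\<^sub>a K (\<pi> \<omega>) (fst z) \<and> positive_mask (snd z))"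
    by measurable
  then show ?thesis by (simp add: case_prod_unfold)
qed

lemma measurable_policy_act_selected:
  "Measurable.pred (F \<Otimes>\<^sub>M D) (\<lambda>(\<omega>, x, m). gate \<alpha>\<^sub>l \<alpha>\<^sub>a K (\<pi> \<omega>) x)"
  using measurable_unit_of_policy[OF measurable_policy_gate] by (simp add: case_prod_unfold)

text \<open>Both incident rates are quotients of finite sums built from mask entries and these pixel
  flags, so their measurability reduces to this event.\<close>

lemma measurable_policy_flagged:
  "Measurable.pred (F \<Otimes>\<^sub>M D)
    (\<lambda>(\<omega>, z). detector (\<pi> \<omega>) (a_star \<alpha>\<^sub>l \<alpha>\<^sub>a K (\<pi> \<omega>) (fst z)) $ u \<ge> detector_threshold (\<pi> \<omega>))"
proof -
  note [measurable] = measurable_unit_of_policy[OF measurable_policy_detector_a_star]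
  have [measurable]: "(\<lambda>\<omega>. detector_threshold (\<pi> \<omega>)) \<in> borel_measurable F"
    using \<pi> by (simp add: policy_measurable_def)
  show ?thesis by measurable
qed

lemma measurable_policy_loss_incident:
  "Measurable.pred (F \<Otimes>\<^sub>M D)
    (\<lambda>(\<omega>, x, m). loss_incident r (\<pi> \<omega>) (a_star \<alpha>\<^sub>l \<alpha>\<^sub>a K (\<pi> \<omega>) x) m)"
proof -
  note [measurable] = measurable_policy_flagged
  have [measurable]: "Measurable.pred D (\<lambda>z. snd z $ u)" for u
    by (rule measurable_unit_mask)
  have "Measurable.pred (F \<Otimes>\<^sub>M D)
    (\<lambda>(\<omega>, z). loss_incident r (\<pi> \<omega>) (a_star \<alpha>\<^sub>l \<alpha>\<^sub>a K (\<pi> \<omega>) (fst z)) (snd z))"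
    unfolding loss_incident_def rec_rate_def by measurable
  then show ?thesis by (simp add: case_prod_unfold)
qed

lemma measurable_policy_act_incident:
  "Measurable.pred (F \<Otimes>\<^sub>M D)
    (\<lambda>(\<omega>, x, m). act_incident f (\<pi> \<omega>) (a_star \<alpha>\<^sub>l \<alpha>\<^sub>a K (\<pi> \<omega>) x) m)"
proof -
  note [measurable] = measurable_policy_flagged
  have [measurable]: "Measurable.pred D (\<lambda>z. snd z $ u)" for u
    by (rule measurable_unit_mask)
  have "Measurable.pred (F \<Otimes>\<^sub>M D)
    (\<lambda>(\<omega>, z). act_incident f (\<pi> \<omega>) (a_star \<alpha>\<^sub>l \<alpha>\<^sub>a K (\<pi> \<omega>) (fst z)) (snd z))"
    unfolding act_incident_def fpr_clean_def by measurable
  then show ?thesis by (simp add: case_prod_unfold)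
qed

end

end


section \<open>Certificates\<close>

text \<open>Selection and incident stay abstract so that both kinds of incident are instances. At a
  frozen outcome the risk is a constant: either it is at most \<alpha> and the event is empty, or
  the bound for a fixed distribution applies.\<close>

lemma risk_version_certificate:
  fixes sel inc :: "'a \<Rightarrow> 'z \<Rightarrow> bool" and N :: nat
  assumes R: "risk_version F D inc sel R" and D: "prob_space D" and I: "finite I"
    and sel: "Measurable.pred (F \<Otimes>\<^sub>M D) (\<lambda>(\<omega>, z). sel \<omega> z)"
    and inc: "Measurable.pred (F \<Otimes>\<^sub>M D) (\<lambda>(\<omega>, z). inc \<omega> z)"
    and \<gamma>: "0 < \<gamma>" and \<alpha>: "0 \<le> \<alpha>"
  defines "V \<equiv> \<lambda>\<omega> z. clopper_pearson (\<Sum>i\<in>I. of_bool (sel \<omega> (z i) \<and> inc \<omega> (z i)))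
    (\<Sum>i\<in>I. of_bool (sel \<omega> (z i))) \<gamma>"
  shows "(\<lambda>(\<omega>, z). V \<omega> z) \<in> F \<Otimes>\<^sub>M (\<Pi>\<^sub>M i\<in>I. D) \<rightarrow>\<^sub>M count_space UNIV"
    and "\<And>\<omega>. \<omega> \<in> space F \<Longrightarrow>
      measure (\<Pi>\<^sub>M i\<in>I. D) {z \<in> space (\<Pi>\<^sub>M i\<in>I. D). V \<omega> z \<le> \<alpha> \<and> R \<omega> > \<alpha>} \<le> \<gamma>"
proof -
  have comp: "Measurable.pred (F \<Otimes>\<^sub>M (\<Pi>\<^sub>M i\<in>I. D)) (\<lambda>(\<omega>, z). Q \<omega> (z i))"
    if "i \<in> I" "Measurable.pred (F \<Otimes>\<^sub>M D) (\<lambda>(\<omega>, z). Q \<omega> z)" for Q :: "'a \<Rightarrow> 'z \<Rightarrow> bool" and i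
  proof -
    note [measurable] = that(1)
    have "(\<lambda>(\<omega>, z). (\<omega>, z i)) \<in> F \<Otimes>\<^sub>M (\<Pi>\<^sub>M i\<in>I. D) \<rightarrow>\<^sub>M F \<Otimes>\<^sub>M D" by measurable
    from measurable_compose[OF this that(2)] show ?thesis by (simp add: case_prod_unfold)
  qed
  have count: "(\<lambda>(\<omega>, z). \<Sum>i\<in>I. of_bool (Q \<omega> (z i)) :: nat)
      \<in> F \<Otimes>\<^sub>M (\<Pi>\<^sub>M i\<in>I. D) \<rightarrow>\<^sub>M count_space UNIV"
    if "Measurable.pred (F \<Otimes>\<^sub>M D) (\<lambda>(\<omega>, z). Q \<omega> z)" for Q :: "'a \<Rightarrow> 'z \<Rightarrow> bool"
  proof -
    have "(\<lambda>x. of_bool (case x of (\<omega>, z) \<Rightarrow> Q \<omega> (z i)) :: nat)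
      \<in> F \<Otimes>\<^sub>M (\<Pi>\<^sub>M i\<in>I. D) \<rightarrow>\<^sub>M count_space UNIV" if "i \<in> I" for i
      by (rule measurable_compose[OF comp[OF that \<open>Measurable.pred (F \<Otimes>\<^sub>M D) (\<lambda>(\<omega>, z). Q \<omega> z)\<close>]]) simp
    then have "(\<lambda>x. \<Sum>i\<in>I. of_bool (case x of (\<omega>, z) \<Rightarrow> Q \<omega> (z i)) :: nat)
      \<in> F \<Otimes>\<^sub>M (\<Pi>\<^sub>M i\<in>I. D) \<rightarrow>\<^sub>M count_space UNIV"
      by measurable
    then show ?thesis by (simp add: case_prod_unfold)
  qed
  have "Measurable.pred (F \<Otimes>\<^sub>M D) (\<lambda>(\<omega>, z). sel \<omega> z \<and> inc \<omega> z)"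
    using sel inc by (simp add: case_prod_unfold)
  note counts [measurable] = count[OF this] count[OF sel]
  \<comment> \<open>The bound is a function of two natural-valued counts, and every function on a
    countable discrete space is measurable.\<close>
  show "(\<lambda>(\<omega>, z). V \<omega> z) \<in> F \<Otimes>\<^sub>M (\<Pi>\<^sub>M i\<in>I. D) \<rightarrow>\<^sub>M count_space UNIV"
    unfolding V_def by measurable
  fix \<omega> assume \<omega>: "\<omega> \<in> space F"
  show "measure (\<Pi>\<^sub>M i\<in>I. D) {z \<in> space (\<Pi>\<^sub>M i\<in>I. D). V \<omega> z \<le> \<alpha> \<and> R \<omega> > \<alpha>} \<le> \<gamma>"
  proof (cases "R \<omega> > \<alpha>")
    case True
    have "Measurable.pred D (sel \<omega>)" "Measurable.pred D (inc \<omega>)"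
      using measurable_Pair2[OF sel \<omega>] measurable_Pair2[OF inc \<omega>] by simp_all
    from measure_PiM_clopper_pearson_le[OF I D this \<gamma> \<alpha> True] R \<omega> True
    show ?thesis by (simp add: risk_version_def V_def)
  next
    case False
    then show ?thesis using \<gamma> by simp
  qed
qed

text \<open>Freezing identifies the conditional probability of \<open>E\<close> with the measure of
  the section of a joint bad set at the outcome, so a bound on every section is enough.\<close>

lemma two_certificates_risk_bound:
  fixes sel\<^sub>1 inc\<^sub>1 sel\<^sub>2 inc\<^sub>2 :: "'a \<Rightarrow> 'z \<Rightarrow> bool" and Z :: "'i \<Rightarrow> 'a \<Rightarrow> 'z"
  assumes P: "prob_space P" and F: "subalgebra P F" and D: "prob_space D" and I: "finite I"
    and Z: "cond_iid P F D I Z"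
    and indep: "prob_space.indep_set P (sets F)
      (sets (vimage_algebra (space P) (\<lambda>\<omega>. \<lambda>i\<in>I. Z i \<omega>) (\<Pi>\<^sub>M i\<in>I. D)))"
    and R\<^sub>1: "risk_version F D inc\<^sub>1 sel\<^sub>1 R\<^sub>1" and R\<^sub>2: "risk_version F D inc\<^sub>2 sel\<^sub>2 R\<^sub>2"
    and sel\<^sub>1: "Measurable.pred (F \<Otimes>\<^sub>M D) (\<lambda>(\<omega>, z). sel\<^sub>1 \<omega> z)"
    and inc\<^sub>1: "Measurable.pred (F \<Otimes>\<^sub>M D) (\<lambda>(\<omega>, z). inc\<^sub>1 \<omega> z)"
    and sel\<^sub>2: "Measurable.pred (F \<Otimes>\<^sub>M D) (\<lambda>(\<omega>, z). sel\<^sub>2 \<omega> z)"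
    and inc\<^sub>2: "Measurable.pred (F \<Otimes>\<^sub>M D) (\<lambda>(\<omega>, z). inc\<^sub>2 \<omega> z)"
    and \<delta>: "0 < \<delta>" and \<alpha>: "0 \<le> \<alpha>\<^sub>1" "0 \<le> \<alpha>\<^sub>2"
  defines "U\<^sub>1 \<equiv> \<lambda>\<omega> z. clopper_pearson (\<Sum>i\<in>I. of_bool (sel\<^sub>1 \<omega> (z i) \<and> inc\<^sub>1 \<omega> (z i)))
      (\<Sum>i\<in>I. of_bool (sel\<^sub>1 \<omega> (z i))) (\<delta> / 2)"
    and "U\<^sub>2 \<equiv> \<lambda>\<omega> z. clopper_pearson (\<Sum>i\<in>I. of_bool (sel\<^sub>2 \<omega> (z i) \<and> inc\<^sub>2 \<omega> (z i)))
      (\<Sum>i\<in>I. of_bool (sel\<^sub>2 \<omega> (z i))) (\<delta> / 2)"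
  defines "E \<equiv> {\<omega> \<in> space P. U\<^sub>1 \<omega> (\<lambda>i. Z i \<omega>) \<le> \<alpha>\<^sub>1 \<and> U\<^sub>2 \<omega> (\<lambda>i. Z i \<omega>) \<le> \<alpha>\<^sub>2 \<and>
      (R\<^sub>1 \<omega> > \<alpha>\<^sub>1 \<or> R\<^sub>2 \<omega> > \<alpha>\<^sub>2)}"
  shows "E \<in> sets P" "AE \<omega> in P. real_cond_exp P F (indicat_real E) \<omega> \<le> \<delta>" "measure P E \<le> \<delta>"
proof -
  interpret P: prob_space P by (rule P)
  interpret D: prob_space D by (rule D)
  interpret D: prob_space D by (rule D)
  interpret D: prob_space D by (rule D)
  interpret D: prob_space D by (rule D)
  interpret D: prob_space D by (rule D)
  interpret Q: finite_product_prob_space "\<lambda>_. D" I by standard (rule I)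
  interpret F: finite_measure_subalgebra P F by standard (rule F)
  let ?Q = "\<Pi>\<^sub>M i\<in>I. D" and ?X = "\<lambda>\<omega>. \<lambda>i\<in>I. Z i \<omega>"
  have X: "?X \<in> P \<rightarrow>\<^sub>M ?Q"
    using Z by (intro measurable_restrict) (simp add: cond_iid_def)
  have distr: "distr P (F \<Otimes>\<^sub>M ?Q) (\<lambda>\<omega>. (\<omega>, ?X \<omega>)) = restr_to_subalg P F \<Otimes>\<^sub>M ?Q"
    using distr_Pair_indep[OF P F X indep] distr_cond_iid[OF P F D I Z] by simp
  have \<gamma>: "0 < \<delta> / 2" using \<delta> by simp
  note cert\<^sub>1 = risk_version_certificate[OF R\<^sub>1 D I sel\<^sub>1 inc\<^sub>1 \<gamma> \<alpha>(1), folded U\<^sub>1_def]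
  note cert\<^sub>2 = risk_version_certificate[OF R\<^sub>2 D I sel\<^sub>2 inc\<^sub>2 \<gamma> \<alpha>(2), folded U\<^sub>2_def]
  have meas [measurable]: "(\<lambda>(\<omega>, z). U\<^sub>1 \<omega> z) \<in> borel_measurable (F \<Otimes>\<^sub>M ?Q)"
    "(\<lambda>(\<omega>, z). U\<^sub>2 \<omega> z) \<in> borel_measurable (F \<Otimes>\<^sub>M ?Q)"
    using measurable_compose[OF cert\<^sub>1(1), of "\<lambda>x. x" borel]
      measurable_compose[OF cert\<^sub>2(1), of "\<lambda>x. x" borel] by simp_all
  have [measurable]: "R\<^sub>1 \<in> borel_measurable F" "R\<^sub>2 \<in> borel_measurable F"
    using R\<^sub>1 R\<^sub>2 by (simp_all add: risk_version_def)
  \<comment> \<open>\<open>B\<close> is the bad event in terms of outcome and sample as separate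
    variables; \<open>E\<close> is its preimage under pairing each outcome with its own
    sample.\<close>
  define B where "B = {x \<in> space (F \<Otimes>\<^sub>M ?Q). case x of (\<omega>, z) \<Rightarrow>
    U\<^sub>1 \<omega> z \<le> \<alpha>\<^sub>1 \<and> U\<^sub>2 \<omega> z \<le> \<alpha>\<^sub>2 \<and> (R\<^sub>1 \<omega> > \<alpha>\<^sub>1 \<or> R\<^sub>2 \<omega> > \<alpha>\<^sub>2)}"
  have B: "B \<in> sets (F \<Otimes>\<^sub>M ?Q)"
    unfolding B_def by measurable
  \<comment> \<open>Next, \<open>U_X\<close> identifies the bounds of the restricted sample
    \<open>?X\<close> with those of \<open>Z\<close>: the counts only look at indices in I.\<close>
  have sp: "space F = space P" using F by (simp add: subalgebra_def)
  have U_X: "U\<^sub>1 \<omega> (?X \<omega>) = U\<^sub>1 \<omega> (\<lambda>i. Z i \<omega>)" "U\<^sub>2 \<omega> (?X \<omega>) = U\<^sub>2 \<omega> (\<lambda>i. Z i \<omega>)" for \<omega>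
    unfolding U\<^sub>1_def U\<^sub>2_def by simp_all
  have E_eq: "E = {\<omega> \<in> space P. (\<omega>, ?X \<omega>) \<in> B}"
    using measurable_space[OF X] by (auto simp: E_def B_def space_pair_measure sp U_X simp del: restrict_apply)
  note freeze = real_cond_exp_freezing[OF P F Q.prob_space_axioms X distr B, folded E_eq]
  show E: "E \<in> sets P" by (rule freeze(1))
  have section_le: "measure ?Q (Pair \<omega> -` B) \<le> \<delta>" if \<omega>: "\<omega> \<in> space P" for \<omega>
  proof -
    define A\<^sub>1 where "A\<^sub>1 = {z \<in> space ?Q. U\<^sub>1 \<omega> z \<le> \<alpha>\<^sub>1 \<and> R\<^sub>1 \<omega> > \<alpha>\<^sub>1}"
    define A\<^sub>2 where "A\<^sub>2 = {z \<in> space ?Q. U\<^sub>2 \<omega> z \<le> \<alpha>\<^sub>2 \<and> R\<^sub>2 \<omega> > \<alpha>\<^sub>2}"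
    have [measurable]: "U\<^sub>1 \<omega> \<in> borel_measurable ?Q" "U\<^sub>2 \<omega> \<in> borel_measurable ?Q"
      using measurable_Pair2[OF meas(1), of \<omega>] measurable_Pair2[OF meas(2), of \<omega>] \<omega> sp by simp_all
    have A [measurable]: "A\<^sub>1 \<in> sets ?Q" "A\<^sub>2 \<in> sets ?Q"
      unfolding A\<^sub>1_def A\<^sub>2_def by measurable
    \<comment> \<open>A bad sample passes both certificates while some risk is too large, so it is
      already bad for the certificate of that risk.\<close>
    have "Pair \<omega> -` B \<subseteq> A\<^sub>1 \<union> A\<^sub>2"
      by (auto simp: B_def A\<^sub>1_def A\<^sub>2_def space_pair_measure)
    then have "measure ?Q (Pair \<omega> -` B) \<le> measure ?Q (A\<^sub>1 \<union> A\<^sub>2)"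
      using A by (intro Q.finite_measure_mono) auto
    also have "\<dots> \<le> measure ?Q A\<^sub>1 + measure ?Q A\<^sub>2"
      using A by (intro measure_Un_le)
    also have "\<dots> \<le> \<delta> / 2 + \<delta> / 2"
      using cert\<^sub>1(2)[of \<omega>] cert\<^sub>2(2)[of \<omega>] \<omega> sp unfolding A\<^sub>1_def A\<^sub>2_def U\<^sub>1_def U\<^sub>2_def
      by (intro add_mono) simp_all
    finally show ?thesis by simp
  qed
  show AE: "AE \<omega> in P. real_cond_exp P F (indicat_real E) \<omega> \<le> \<delta>"
    using freeze(2) AE_space by eventually_elim (simp add: section_le)
  have int: "integrable P (indicat_real E)"
    using E by (simp add: P.emeasure_eq_measure)
  \<comment> \<open>The unconditional bound follows by integrating the conditional one.\<close>
  have "measure P E = (\<integral>\<omega>. indicat_real E \<omega> \<partial>P)"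
    using E by (simp add: Int_absorb1 sets.sets_into_space)
  also have "\<dots> = (\<integral>\<omega>. real_cond_exp P F (indicat_real E) \<omega> \<partial>P)"
    by (rule F.real_cond_exp_int(2)[OF int, symmetric])
  also have "\<dots> \<le> (\<integral>\<omega>. \<delta> \<partial>P)"
    using AE F.real_cond_exp_int(1)[OF int] by (intro integral_mono_AE) auto
  also have "\<dots> = \<delta>" by (simp add: P.prob_space)
  finally show "measure P E \<le> \<delta>" .
qed

theorem proposition1:
  fixes P F\<^sub>0 :: "'a measure"
    and SX :: "'x measure"
    and D :: "('x \<times> ('h::finite, 'w::finite) mask) measure"
    and \<pi> :: "'a \<Rightarrow> ('x, 'h, 'w) policy"
    and Z :: "nat \<Rightarrow> 'a \<Rightarrow> 'x \<times> ('h, 'w) mask"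
    and R_loss R_act :: "'a \<Rightarrow> real"
    and \<alpha>\<^sub>l \<alpha>\<^sub>a \<delta> r\<^sub>0 f\<^sub>0 :: real
    and K N :: nat
  assumes "prob_space P" and "subalgebra P F\<^sub>0"
    and "K \<ge> 1" and "policy_measurable F\<^sub>0 SX K \<pi>"
    and "prob_space D" and "sets D = sets (unit_space SX)"
    and "cond_iid P F\<^sub>0 D {1..N} Z"
    and "prob_space.indep_set P (sets F\<^sub>0)
           (sets (vimage_algebra (space P) (\<lambda>\<omega>. \<lambda>i\<in>{1..N}. Z i \<omega>) (\<Pi>\<^sub>M i\<in>{1..N}. D)))"
    and "0 < \<alpha>\<^sub>l" "\<alpha>\<^sub>l < 1" and "0 < \<alpha>\<^sub>a" "\<alpha>\<^sub>a < 1" and "0 < \<delta>" "\<delta> < 1"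
    and "0 \<le> r\<^sub>0" "r\<^sub>0 \<le> 1" and "0 \<le> f\<^sub>0" "f\<^sub>0 \<le> 1"
    and "loss_risk_version \<alpha>\<^sub>l \<alpha>\<^sub>a r\<^sub>0 K F\<^sub>0 D \<pi> R_loss"
    and "act_risk_version \<alpha>\<^sub>l \<alpha>\<^sub>a f\<^sub>0 K F\<^sub>0 D \<pi> R_act"
  shows
    "let U_loss = (\<lambda>\<omega>. clopper_pearson
           (e_loss \<alpha>\<^sub>l \<alpha>\<^sub>a r\<^sub>0 K N (\<pi> \<omega>) (\<lambda>i. Z i \<omega>))
           (n_loss \<alpha>\<^sub>l \<alpha>\<^sub>a K N (\<pi> \<omega>) (\<lambda>i. Z i \<omega>)) (\<delta> / 2));
         U_act = (\<lambda>\<omega>. clopper_pearson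
           (e_act \<alpha>\<^sub>l \<alpha>\<^sub>a f\<^sub>0 K N (\<pi> \<omega>) (\<lambda>i. Z i \<omega>))
           (n_act \<alpha>\<^sub>l \<alpha>\<^sub>a K N (\<pi> \<omega>) (\<lambda>i. Z i \<omega>)) (\<delta> / 2));
         E = {\<omega> \<in> space P. U_loss \<omega> \<le> \<alpha>\<^sub>l \<and> U_act \<omega> \<le> \<alpha>\<^sub>a \<and>
                (R_loss \<omega> > \<alpha>\<^sub>l \<or> R_act \<omega> > \<alpha>\<^sub>a)}
     in E \<in> sets P \<and>
        (AE \<omega> in P. real_cond_exp P F\<^sub>0 (indicat_real E) \<omega> \<le> \<delta>) \<and>
        measure P E \<le> \<delta>"
proof -
  have "finite {1..N}" by simp
  note certificates = two_certificates_risk_bound[OF assms(1,2,5) this assms(7,8)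
      assms(19)[unfolded loss_risk_version_def] assms(20)[unfolded act_risk_version_def]
      measurable_policy_loss_selected[OF assms(4,3,6)] measurable_policy_loss_incident[OF assms(4,3,6)]
      measurable_policy_act_selected[OF assms(4,3,6)] measurable_policy_act_incident[OF assms(4,3,6)]
      assms(13) less_imp_le[OF assms(9)] less_imp_le[OF assms(11)]]
  \<comment> \<open>The abstract counts group gate and mask as the selection and add the incident;
    reassociating the conjunctions yields the counts of the policy.\<close>
  show ?thesis
    using certificates
    by (simp only: Let_def n_loss_def e_loss_def n_act_def e_act_def case_prod_unfold conj_assoc)
qed

end
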